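(* Let $X,Y$ be sets with $2\leq|X|<\aleph_0$ and $2\leq|Y|\leq\aleph_0$, and let $a$ be a function from $Y$ to $X$ with $\alpha=\operatorname{rank}(a)$. (i) If $\alpha=|Y|<|X|<\aleph_0$, then $\operatorname{rank}(\mathcal T_{XY}^a)=S(|X|,\alpha)$. (ii) If $\alpha=|X|<|Y|\leq\aleph_0$, then $\operatorname{rank}(\mathcal T_{XY}^a)=\binom{|Y|}{\alpha}$.
   Context: Maps are written on the right and composed left to right. $\mathcal T_{XY}$ is the set of all (totally defined) functions $X\to Y$; $\mathcal T_{XY}^a$ is the sandwich semigroup $(\mathcal T_{XY},\star_a)$ with $f\star_ag=fag$. For a function, $\operatorname{rank}(a)=|\operatorname{im}(a)|$; for a semigroup $T$, $\operatorname{rank}(T)$ is the least cardinality of a generating set (as a semigroup). $\binom{\kappa}{\mu}$ is the number of subsets of size $\mu$ of a set of size $\kappa$ (so it is $\aleph_0$ when $\kappa=\aleph_0$ and $1\leq\mu<\aleph_0$), and $S(n,\mu)$ is the number of equivalence relations with exactly $\mu$ classes on a set of size $n$. *)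

theory Defs
  imports Main "HOL-Library.FuncSet"
begin

unbundle cardinal_syntax

text \<open>
  Cardinal numbers are represented by the cardinal orders of Main, up to \<open>=o\<close>:
  \<open>natLeq\<close> is aleph-zero, \<open>ctwo\<close> is 2, and \<open>Field \<kappa>\<close> is a set of size \<open>\<kappa>\<close>
  (so \<open>Field |A| = A\<close>).
\<close>

definition map_rank :: "'b set \<Rightarrow> ('b \<Rightarrow> 'a) \<Rightarrow> 'a rel"
  where "map_rank Y a = |a ` Y|"

definition binomial_card :: "'a rel \<Rightarrow> 'b rel \<Rightarrow> 'a set rel"
  where "binomial_card \<kappa> \<mu> = |{A. A \<subseteq> Field \<kappa> \<and> |A| =o \<mu>}|"

definition stirling_card :: "'a rel \<Rightarrow> 'b rel \<Rightarrow> 'a rel rel"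
  where "stirling_card \<kappa> \<mu> = |{E. equiv (Field \<kappa>) E \<and> |Field \<kappa> // E| =o \<mu>}|"

inductive_set generated_subsemigroup :: "('s \<Rightarrow> 's \<Rightarrow> 's) \<Rightarrow> 's set \<Rightarrow> 's set"
  for mul :: "'s \<Rightarrow> 's \<Rightarrow> 's" and G :: "'s set"
  where
    incl: "g \<in> G \<Longrightarrow> g \<in> generated_subsemigroup mul G"
  | mult: "\<lbrakk>s \<in> generated_subsemigroup mul G; t \<in> generated_subsemigroup mul G\<rbrakk>
            \<Longrightarrow> mul s t \<in> generated_subsemigroup mul G"

definition semigroup_generates :: "'s set \<Rightarrow> ('s \<Rightarrow> 's \<Rightarrow> 's) \<Rightarrow> 's set \<Rightarrow> bool"
  where "semigroup_generates S mul G \<longleftrightarrow> G \<subseteq> S \<and> generated_subsemigroup mul G = S"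

definition semigroup_rank :: "'s set \<Rightarrow> ('s \<Rightarrow> 's \<Rightarrow> 's) \<Rightarrow> 's rel"
  where "semigroup_rank S mul =
    |SOME G. semigroup_generates S mul G \<and> (\<forall>H. semigroup_generates S mul H \<longrightarrow> |G| \<le>o |H| )|"

abbreviation full_maps :: "'a set \<Rightarrow> 'b set \<Rightarrow> ('a \<Rightarrow> 'b) set"
  where "full_maps X Y \<equiv> X \<rightarrow>\<^sub>E Y"

text \<open>Maps are composed from left to right: first \<open>f\<close>, then \<open>a\<close>, then \<open>g\<close>.\<close>

definition sandwich :: "'a set \<Rightarrow> ('b \<Rightarrow> 'a) \<Rightarrow> ('a \<Rightarrow> 'b) \<Rightarrow> ('a \<Rightarrow> 'b) \<Rightarrow> ('a \<Rightarrow> 'b)"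
  where "sandwich X a f g = compose X g (compose X a f)"

lemma sandwich_closed:
  assumes "a \<in> full_maps Y X" "f \<in> full_maps X Y" "g \<in> full_maps X Y"
  shows "sandwich X a f g \<in> full_maps X Y"
  using assms by (auto simp: sandwich_def compose_def PiE_iff)

lemma sandwich_assoc:
  assumes "a \<in> full_maps Y X" "f \<in> full_maps X Y" "g \<in> full_maps X Y"
  shows "sandwich X a (sandwich X a f g) h = sandwich X a f (sandwich X a g h)"
  using assms by (auto simp: sandwich_def compose_def PiE_iff fun_eq_iff)

text \<open>The minimum in \<open>semigroup_rank\<close> is attained for every set closed under the operation.\<close>

lemma semigroup_rank_attained:
  assumes closed: "\<And>s t. s \<in> S \<Longrightarrow> t \<in> S \<Longrightarrow> mul s t \<in> S"
  shows "\<exists>G. semigroup_generates S mul G \<and> semigroup_rank S mul = |G| \<and>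
           (\<forall>H. semigroup_generates S mul H \<longrightarrow> |G| \<le>o |H| )"
proof -
  have "s \<in> S" if "s \<in> generated_subsemigroup mul S" for s
    using that by induction (auto intro: closed)
  then have "semigroup_generates S mul S"
    by (auto simp: semigroup_generates_def intro: generated_subsemigroup.incl)
  then have "card_of ` {G. semigroup_generates S mul G} \<noteq> {}"
    by blast
  from exists_minim_Card_order[OF this]
  have "\<exists>G. semigroup_generates S mul G \<and> (\<forall>H. semigroup_generates S mul H \<longrightarrow> |G| \<le>o |H| )"
    by (auto simp: card_of_Card_order)
  from someI_ex[OF this] show ?thesis
    unfolding semigroup_rank_def by blast
qed

end

theory Submission
  imports Defs "HOL-Combinatorics.Cycles"
begin

text \<open>
  Call a map top if it is surjective (when \<open>a\<close> is injective but not surjective) or injective (when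
  \<open>a\<close> is surjective but not injective). If \<open>f a g\<close> is top, then in the first case \<open>f\<close> is top with
  the same kernel, and in the second \<open>g\<close> is top with the same image. So a generating set contains a
  top map for each kernel (image), which is the lower bound. Conversely, choose one top map for each
  kernel (image). Since \<open>a\<close> is not bijective, at least two kernels are separated by the image of
  \<open>a\<close> (two images are transversals of the kernel of \<open>a\<close>), and the top maps chosen for these two can
  be taken to act, via \<open>a\<close>, as two generators of the symmetric group. All top maps are
  then generated, and every other map is a product of a map of larger rank and a top map.
\<close>

section \<open>Two generators of a finite symmetric group\<close>

text \<open>Conjugating the swap \<open>t\<close> of the first two entries by powers of the full
  cycle \<open>c\<close> gives all swaps of neighbours, hence all transpositions, and these
  generate. Inverses and the identity are obtained as powers of \<open>c\<close>.\<close>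

lemma symmetric_group_two_generated:
  assumes "finite S"
  shows "\<exists>p q. semigroup_generates {r. r permutes S} (\<circ>) {p, q}"
proof -
  obtain xs where xs: "distinct xs" "set xs = S"
    using finite_distinct_list[OF assms] by blast
  define n where "n = length xs"
  define c where "c = cycle_of_list xs"
  \<comment> \<open>the transposition of the first two elements, or the identity if \<open>S\<close> has fewer than two\<close>
  define t where "t = cycle_of_list (take 2 xs)"
  define H where "H = generated_subsemigroup (\<circ>) {c, t}"
  have c: "c permutes S"
    using cycle_permutes[of xs] xs by (simp add: c_def)
  have t: "t permutes S"
    using permutes_subset[OF cycle_permutes[of "take 2 xs"]] xs set_take_subset[of 2 xs]
    by (auto simp: t_def)
  have mult: "u \<circ> v \<in> H" if "u \<in> H" "v \<in> H" for u v
    using that unfolding H_def by (rule generated_subsemigroup.mult)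
  have cH: "c \<in> H" and tH: "t \<in> H"
    unfolding H_def by (auto intro: generated_subsemigroup.incl)
  have root: "c ^^ n = id"
    unfolding c_def n_def using xs(1) by (rule cycle_is_id_root)
  have Suc_pow: "c ^^ Suc k \<in> H" for k
  proof (induction k)
    case (Suc k)
    from mult[OF cH this] show ?case by (simp only: funpow.simps(2))
  qed (use cH in \<open>simp only: funpow.simps comp_id\<close>)
  \<comment> \<open>The closure rules do not supply the identity: it is \<open>c ^^ n\<close> if
    \<open>n > 0\<close>, and \<open>c\<close> itself if \<open>S\<close> is empty.\<close>
  have id: "id \<in> H"
  proof (cases n)
    case 0
    then show ?thesis using cH by (simp add: c_def n_def)
  next
    case (Suc m)
    then show ?thesis using Suc_pow[of m] root by simp
  qed
  have pow: "c ^^ k \<in> H" for k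
    using id Suc_pow by (cases k) (auto simp del: funpow.simps(2))
  have adjacent: "transpose (xs ! i) (xs ! Suc i) \<in> H" if i: "Suc i < n" for i
  proof -
    have inv: "inv (c ^^ i) = c ^^ (n - i)"
    proof (rule inv_unique_comp)
      show "(c ^^ i) \<circ> (c ^^ (n - i)) = id" "(c ^^ (n - i)) \<circ> (c ^^ i) = id"
        using i root by (simp_all flip: funpow_add)
    qed
    have bij: "bij (c ^^ i)"
      using permutes_bij[OF c] by (rule bij_fn)
    \<comment> \<open>\<open>c ^^ i\<close> shifts the list by \<open>i\<close>; since
      \<open>Suc i < n\<close>, the first two entries land on neighbours without wrapping
      around.\<close>
    have "map (c ^^ i) (take 2 xs) = take 2 (rotate i xs)"
      using cyclic_rotation[OF xs(1), of i] by (simp add: c_def flip: take_map)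
    also have "\<dots> = [xs ! i, xs ! Suc i]"
    proof (rule nth_equalityI)
      have "rotate i xs ! j = xs ! (i + j)" if "i + j < n" for j
        using that nth_rotate[of j xs i] by (simp add: n_def add.commute)
      from this[of 0] this[of 1] i
      show "take 2 (rotate i xs) ! j = [xs ! i, xs ! Suc i] ! j"
        if "j < length (take 2 (rotate i xs))" for j
        using that by (auto simp: less_Suc_eq numeral_2_eq_2)
    qed (use i in \<open>simp add: n_def\<close>)
    finally have "(c ^^ i) \<circ> t \<circ> (c ^^ (n - i)) = cycle_of_list [xs ! i, xs ! Suc i]"
      using conjugation_of_cycle[of "take 2 xs", OF _ bij] xs(1) by (simp add: t_def inv)
    then have "(c ^^ i) \<circ> t \<circ> (c ^^ (n - i)) = transpose (xs ! i) (xs ! Suc i)"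
      by simp
    then show ?thesis
      using mult[OF mult[OF pow tH] pow] by metis
  qed
  \<comment> \<open>Conjugating the swap of entries \<open>i\<close> and \<open>Suc i\<close> by the
    swap of entries \<open>0\<close> and \<open>i\<close> replaces entry \<open>i\<close> by entry
    \<open>0\<close>.\<close>
  have first: "transpose (xs ! 0) (xs ! i) \<in> H" if "i < n" for i
    using that
  proof (induction i)
    case 0
    show ?case using id unfolding transpose_same .
  next
    case (Suc i)
    show ?case
    proof (cases "i = 0")
      case True
      then show ?thesis using adjacent[of 0] Suc.prems by simp
    next
      case False
      have len: "0 < length xs" "i < length xs" "Suc i < length xs"
        using Suc.prems by (auto simp: n_def)
      have "xs ! 0 \<noteq> xs ! Suc i" "xs ! i \<noteq> xs ! Suc i"
        using nth_eq_iff_index_eq[OF xs(1) len(1,3)] nth_eq_iff_index_eq[OF xs(1) len(2,3)]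
        by simp_all
      then have "transpose (xs ! 0) (xs ! i) \<circ> transpose (xs ! i) (xs ! Suc i)
          \<circ> transpose (xs ! 0) (xs ! i) = transpose (xs ! 0) (xs ! Suc i)"
        by (rule transpose_comp_triple)
      moreover have "transpose (xs ! 0) (xs ! i) \<in> H"
        using Suc by simp
      ultimately show ?thesis
        using mult adjacent[OF Suc.prems] by metis
    qed
  qed
  have transp: "transpose u v \<in> H" if uv: "u \<in> S" "v \<in> S" "u \<noteq> v" for u v
  proof -
    have *: "transpose (xs ! 0) w \<in> H" if "w \<in> S" for w
      using that first xs(2) by (metis in_set_conv_nth n_def)
    show ?thesis
    proof (cases "v = xs ! 0")
      case True
      then show ?thesis using *[OF uv(1)] by (simp add: transpose_commute)
    next
      case False
      \<comment> \<open>The same conjugation, with \<open>xs ! 0\<close> as intermediate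
        point.\<close>
      have "transpose u (xs ! 0) \<circ> transpose (xs ! 0) v \<circ> transpose u (xs ! 0) = transpose u v"
        using uv False by (intro transpose_comp_triple) auto
      moreover have "transpose u (xs ! 0) \<in> H"
        using *[OF uv(1)] by (simp add: transpose_commute)
      ultimately show ?thesis
        using mult *[OF uv(2)] by metis
    qed
  qed
  have "r \<in> H" if "r permutes S" for r
    using that assms
  proof (induction rule: permutes_induct)
    case id
    show ?case by (fact \<open>id \<in> H\<close>)
  next
    case (swap a b p)
    then show ?case using mult transp by metis
  qed
  moreover have "r permutes S" if "r \<in> H" for r
    using that unfolding H_def
  proof induction
    case (incl g)
    then show ?case using c t by blast
  next
    case (mult u v)
    then show ?case by (simp only: permutes_compose)
  qed
  ultimately have "semigroup_generates {r. r permutes S} (\<circ>) {c, t}"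
    using c t by (auto simp: semigroup_generates_def simp flip: H_def)
  then show ?thesis by blast
qed

section \<open>Rank of a semigroup through an invariant\<close>

text \<open>A choice of preimages under \<open>k\<close> is overridden at \<open>k f\<close> and
  \<open>k g\<close>; as these values differ, both prescribed elements survive.\<close>

lemma extend_to_section:
  assumes "f \<in> U" "g \<in> U" "k f \<noteq> k g"
  shows "\<exists>G \<subseteq> U. f \<in> G \<and> g \<in> G \<and> inj_on k G \<and> k ` G = k ` U"
proof -
  define s where "s = (inv_into U k)(k f := f, k g := g)"
  have ks: "s c \<in> U \<and> k (s c) = c" if "c \<in> k ` U" for c
    using that assms by (auto simp: s_def inv_into_into f_inv_into_f)
  have "s ` (k ` U) \<subseteq> U" "k ` s ` (k ` U) = k ` U" "inj_on k (s ` (k ` U))"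
    using ks by (auto simp: inj_on_def image_image)
  moreover have "f = s (k f)" "g = s (k g)"
    using assms(3) by (auto simp: s_def)
  then have "f \<in> s ` (k ` U)" "g \<in> s ` (k ` U)"
    using assms(1,2) by blast+
  ultimately show ?thesis by blast
qed

lemma semigroup_rank_eq_card_of_invariant:
  assumes closed: "\<And>s t. s \<in> S \<Longrightarrow> t \<in> S \<Longrightarrow> mul s t \<in> S"
    and "U \<subseteq> S"
    and factor: "\<And>s t. s \<in> S \<Longrightarrow> t \<in> S \<Longrightarrow> mul s t \<in> U \<Longrightarrow>
      s \<in> U \<and> k s = k (mul s t) \<or> t \<in> U \<and> k t = k (mul s t)"
    and fg: "f \<in> U" "g \<in> U" "k f \<noteq> k g"
    and generating: "\<And>G. G \<subseteq> U \<Longrightarrow> f \<in> G \<Longrightarrow> g \<in> G \<Longrightarrow> k ` G = k ` U \<Longrightarrow>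
      S \<subseteq> generated_subsemigroup mul G"
  shows "semigroup_rank S mul =o |k ` U|"
proof -
  have stays: "s \<in> S" if "s \<in> generated_subsemigroup mul H" "H \<subseteq> S" for s H
    using that by induction (auto intro: closed)
  obtain G where G: "semigroup_generates S mul G" "semigroup_rank S mul = |G|"
    "\<And>H. semigroup_generates S mul H \<Longrightarrow> |G| \<le>o |H|"
    using semigroup_rank_attained[of S mul] closed by blast
  have "k u \<in> k ` G" if "u \<in> U" for u
  proof -
    have "u \<in> generated_subsemigroup mul G"
      using that G(1) \<open>U \<subseteq> S\<close> by (auto simp: semigroup_generates_def)
    then show ?thesis
      using that
    proof induction
      case (mult s t)
      have "s \<in> S" "t \<in> S"
        using mult.hyps G(1) by (auto simp: semigroup_generates_def)
      from factor[OF this mult.prems] mult.IH show ?case by auto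
    qed blast
  qed
  then have lower: "|k ` U| \<le>o |G|"
    by (intro surj_imp_ordLeq) blast
  obtain K where K: "K \<subseteq> U" "f \<in> K" "g \<in> K" "inj_on k K" "k ` K = k ` U"
    using extend_to_section[OF fg] by blast
  have "semigroup_generates S mul K"
    using generating[OF K(1-3,5)] stays K(1) \<open>U \<subseteq> S\<close>
    unfolding semigroup_generates_def by blast
  then have "|G| \<le>o |K|" by (rule G(3))
  moreover have "|K| \<le>o |k ` U|"
    using K(4,5) by (metis card_of_ordLeq order_refl)
  ultimately show ?thesis
    using lower G(2) by (metis ordIso_iff_ordLeq ordLeq_transitive)
qed

section \<open>Kernels of surjections and images of injections\<close>

definition kernel_on :: "'a set \<Rightarrow> ('a \<Rightarrow> 'b) \<Rightarrow> 'a rel"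
  where "kernel_on X f = {(x, x'). x \<in> X \<and> x' \<in> X \<and> f x = f x'}"

text \<open>The classes of the kernel are the fibres, one for each point of \<open>Y\<close>;
  conversely, the quotient map followed by a bijection from the classes to \<open>Y\<close> has the
  given kernel.\<close>

lemma kernels_of_surjections:
  "kernel_on X ` {f \<in> full_maps X Y. f ` X = Y} = {E. equiv X E \<and> |X // E| =o |Y|}"
proof (intro equalityI subsetI)
  fix E assume "E \<in> kernel_on X ` {f \<in> full_maps X Y. f ` X = Y}"
  then obtain f where f: "f \<in> full_maps X Y" "f ` X = Y" and E: "E = kernel_on X f"
    by blast
  have "equiv X E"
    unfolding E kernel_on_def by (auto intro!: equivI refl_onI symI transI)
  moreover have "bij_betw (\<lambda>y. {x \<in> X. f x = y}) Y (X // E)"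
    unfolding bij_betw_def
  proof
    show "inj_on (\<lambda>y. {x \<in> X. f x = y}) Y"
      unfolding f(2)[symmetric] by (rule inj_onI) blast
    have "E `` {x} = {x' \<in> X. f x' = f x}" if "x \<in> X" for x
      using that by (auto simp: E kernel_on_def)
    then show "(\<lambda>y. {x \<in> X. f x = y}) ` Y = X // E"
      unfolding f(2)[symmetric] by (auto simp: quotient_def)
  qed
  then have "|Y| =o |X // E|"
    using card_of_ordIso[of Y "X // E"] by blast
  ultimately show "E \<in> {E. equiv X E \<and> |X // E| =o |Y|}"
    using ordIso_symmetric by blast
next
  fix E assume "E \<in> {E. equiv X E \<and> |X // E| =o |Y|}"
  then obtain b where E: "equiv X E" and b: "bij_betw b (X // E) Y"
    using card_of_ordIso[of "X // E" Y] by auto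
  define f where "f = (\<lambda>x\<in>X. b (E `` {x}))"
  have "f ` X = b ` (X // E)"
    by (auto simp: f_def quotient_def)
  then have im: "f ` X = Y"
    using b by (simp add: bij_betw_def)
  then have "f \<in> full_maps X Y"
    by (auto simp: f_def)
  moreover have "f x = f x' \<longleftrightarrow> (x, x') \<in> E" if "x \<in> X" "x' \<in> X" for x x'
  proof -
    have "b (E `` {x}) = b (E `` {x'}) \<longleftrightarrow> E `` {x} = E `` {x'}"
      using that b by (intro inj_on_eq_iff[of b "X // E"]) (auto simp: bij_betw_def quotientI)
    then show ?thesis
      using that E by (simp add: f_def eq_equiv_class_iff)
  qed
  then have "kernel_on X f = E"
    using equiv_type[OF E] by (auto simp: kernel_on_def)
  ultimately show "E \<in> kernel_on X ` {f \<in> full_maps X Y. f ` X = Y}"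
    using im by blast
qed

lemma images_of_injections:
  "(\<lambda>f. f ` X) ` {f \<in> full_maps X Y. inj_on f X} = {B. B \<subseteq> Y \<and> |B| =o |X|}"
proof (intro equalityI subsetI)
  fix B assume "B \<in> (\<lambda>f. f ` X) ` {f \<in> full_maps X Y. inj_on f X}"
  then obtain f where "f \<in> full_maps X Y" "bij_betw f X B"
    by (auto simp: bij_betw_def)
  then have "|X| =o |B|" "B \<subseteq> Y"
    using card_of_ordIso[of X B] by (auto simp: bij_betw_def)
  then show "B \<in> {B. B \<subseteq> Y \<and> |B| =o |X|}"
    using ordIso_symmetric by blast
next
  fix B assume "B \<in> {B. B \<subseteq> Y \<and> |B| =o |X|}"
  then have "B \<subseteq> Y" "|X| =o |B|"
    using ordIso_symmetric by auto
  then obtain f where f: "B \<subseteq> Y" "bij_betw f X B"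
    using card_of_ordIso[of X B] by auto
  \<comment> \<open>The restriction makes the map extensional, as membership in
    \<open>full_maps\<close> demands.\<close>
  have "(restrict f X) ` X = B" "inj_on (restrict f X) X" "restrict f X \<in> full_maps X Y"
    using f by (auto simp: bij_betw_def)
  then show "B \<in> (\<lambda>f. f ` X) ` {f \<in> full_maps X Y. inj_on f X}"
    by blast
qed

section \<open>Sandwiching with an injective, non-surjective map\<close>

text \<open>The invariant is the kernel and \<open>U\<close> is the set of surjections. The points
  \<open>y0\<close> and \<open>y1\<close> serve to build two generators with different
  kernels.\<close>

lemma semigroup_rank_sandwich_injective:
  assumes X: "finite X" and a: "a \<in> full_maps Y X" "inj_on a Y" "a ` Y \<noteq> X"
    and y: "y0 \<in> Y" "y1 \<in> Y" "y0 \<noteq> y1"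
  shows "semigroup_rank (full_maps X Y) (sandwich X a) =o |{E. equiv X E \<and> |X // E| =o |Y| }|"
proof -
  define U where "U = {f \<in> full_maps X Y. f ` X = Y}"
  have aX: "a v \<in> X" if "v \<in> Y" for v
    using that a(1) by auto
  have Y: "finite Y"
    using X aX a(2) by (metis finite_imageD finite_subset image_subsetI)
  obtain x0 where x0: "x0 \<in> X" "x0 \<notin> a ` Y"
    using a(3) aX by blast
  obtain p q where pq: "semigroup_generates {r. r permutes Y} (\<circ>) {p, q}"
    using symmetric_group_two_generated[OF Y] by blast
  then have pY: "p permutes Y" and qY: "q permutes Y"
    by (auto simp: semigroup_generates_def)
  \<comment> \<open>\<open>lift r v\<close> sends \<open>a w\<close> to \<open>r w\<close>, so right
    multiplication by it postcomposes with \<open>r\<close>. Points off the image of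
    \<open>a\<close> are treated like \<open>a v\<close>, so the choice of \<open>v\<close> controls
    the kernel.\<close>
  define lift where "lift r v = (\<lambda>x\<in>X. r (if x \<in> a ` Y then inv_into Y a x else v))" for r :: "'b \<Rightarrow> 'b" and v
  have lift_a: "lift r v (a w) = r w" if "w \<in> Y" for r v w
    using that aX a(2) by (simp add: lift_def)
  have lift_x0: "lift r v x0 = r v" for r v
    using x0 by (simp add: lift_def)
  have lift_U: "lift r v \<in> U" if r: "r permutes Y" and "v \<in> Y" for r v
  proof -
    have "lift r v ` X \<subseteq> Y"
      using that by (auto simp: lift_def inv_into_into permutes_in_image)
    moreover have "Y \<subseteq> lift r v ` X"
    proof
      fix w assume "w \<in> Y"
      then have "w \<in> r ` Y"
        using permutes_image[OF r] by simp
      then obtain w' where "w' \<in> Y" "r w' = w"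
        by blast
      then show "w \<in> lift r v ` X"
        using lift_a[of w' r v] aX[of w'] by (metis imageI)
    qed
    moreover have "lift r v \<in> extensional X"
      by (simp add: lift_def)
    ultimately show ?thesis
      by (auto simp: U_def PiE_iff)
  qed
  \<comment> \<open>\<open>x0\<close> lies in the class of \<open>a y0\<close> for the first kernel and in that of \<open>a y1\<close> for the second\<close>
  have neq: "kernel_on X (lift p y0) \<noteq> kernel_on X (lift q y1)"
  proof -
    have "(x0, a y0) \<in> kernel_on X (lift p y0)"
      using x0 y aX lift_a lift_x0 by (simp add: kernel_on_def)
    moreover have "q y1 \<noteq> q y0"
      using permutes_inj[OF qY] y(3) by (auto dest: injD)
    then have "(x0, a y0) \<notin> kernel_on X (lift q y1)"
      using y lift_a lift_x0 by (simp add: kernel_on_def)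
    ultimately show ?thesis by blast
  qed
  have "semigroup_rank (full_maps X Y) (sandwich X a) =o |kernel_on X ` U|"
  proof (rule semigroup_rank_eq_card_of_invariant)
    show "sandwich X a s t \<in> full_maps X Y" if "s \<in> full_maps X Y" "t \<in> full_maps X Y" for s t
      using a(1) that by (rule sandwich_closed)
    show "U \<subseteq> full_maps X Y"
      by (auto simp: U_def)
    show "lift p y0 \<in> U" "lift q y1 \<in> U"
      using lift_U pY qY y by auto
    show "kernel_on X (lift p y0) \<noteq> kernel_on X (lift q y1)"
      by (rule neq)
  next
    fix s t assume st: "s \<in> full_maps X Y" "t \<in> full_maps X Y" "sandwich X a s t \<in> U"
    have val: "sandwich X a s t x = t (a (s x))" if "x \<in> X" for x
      using that by (simp add: sandwich_def compose_def)
    have sY: "s ` X \<subseteq> Y"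
      using st(1) by auto
    \<comment> \<open>The product is \<open>s\<close> followed by a map on \<open>Y\<close>.
      Counting makes \<open>s\<close> onto \<open>Y\<close>; the second map is then onto the finite
      set \<open>Y\<close>, hence injective, and leaves the kernel of \<open>s\<close>
      unchanged.\<close>
    have "sandwich X a s t ` X = (\<lambda>v. t (a v)) ` s ` X"
      using val by (auto simp: image_image)
    then have im: "(\<lambda>v. t (a v)) ` s ` X = Y"
      using st(3) by (simp add: U_def)
    then have "card Y \<le> card (s ` X)"
      using card_image_le[of "s ` X"] X by (metis finite_imageI)
    then have s: "s ` X = Y"
      using card_seteq[OF Y sY] by simp
    then have "inj_on (\<lambda>v. t (a v)) Y"
      using im Y by (simp add: eq_card_imp_inj_on)
    then have "t (a (s x)) = t (a (s x')) \<longleftrightarrow> s x = s x'" if "x \<in> X" "x' \<in> X" for x x'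
      using that s by (auto dest: inj_onD)
    then have "kernel_on X s = kernel_on X (sandwich X a s t)"
      by (auto simp: kernel_on_def val)
    then show "s \<in> U \<and> kernel_on X s = kernel_on X (sandwich X a s t) \<or>
        t \<in> U \<and> kernel_on X t = kernel_on X (sandwich X a s t)"
      using s st(1) by (simp add: U_def)
  next
    fix G assume G: "G \<subseteq> U" "lift p y0 \<in> G" "lift q y1 \<in> G" "kernel_on X ` G = kernel_on X ` U"
    \<comment> \<open>The two lifts in \<open>G\<close> realise \<open>p\<close> and
      \<open>q\<close> as postcompositions; induction over words in \<open>p\<close> and
      \<open>q\<close> gives every permutation of \<open>Y\<close>.\<close>
    let ?M = "generated_subsemigroup (sandwich X a) G"
    have "compose X r f \<in> ?M"
      if "r \<in> generated_subsemigroup (\<circ>) {p, q}" "f \<in> ?M" "f \<in> full_maps X Y" for r f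
      using that
    proof (induction arbitrary: f)
      case (incl r)
      then obtain v where v: "lift r v \<in> G"
        using G(2,3) by blast
      have "compose X r f = sandwich X a f (lift r v)"
        using incl.prems(2) lift_a by (auto simp: compose_def sandwich_def fun_eq_iff PiE_iff)
      then show ?case
        using incl.prems(1) v by (auto intro: generated_subsemigroup.intros)
    next
      case (mult s t)
      have "t permutes Y"
        using mult.hyps(2) pq by (auto simp: semigroup_generates_def)
      then have "compose X t f \<in> full_maps X Y"
        using mult.prems(2) by (auto simp: compose_def permutes_in_image)
      then have "compose X s (compose X t f) \<in> ?M"
        using mult by blast
      moreover have "compose X s (compose X t f) = compose X (s \<circ> t) f"
        by (auto simp: compose_def fun_eq_iff)
      ultimately show ?case by metis
    qed
    then have perm: "compose X r f \<in> ?M"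
      if "r permutes Y" "f \<in> ?M" "f \<in> full_maps X Y" for r f
      using that pq by (auto simp: semigroup_generates_def)
    have UM: "u \<in> ?M" if u: "u \<in> U" for u
    proof -
      obtain g where g: "g \<in> G" "kernel_on X g = kernel_on X u"
        using G(4) u by (metis imageE imageI)
      have gU: "g \<in> full_maps X Y" "g ` X = Y"
        using g(1) G(1) by (auto simp: U_def)
      have uU: "u \<in> full_maps X Y" "u ` X = Y"
        using u by (auto simp: U_def)
      \<comment> \<open>Two surjections with the same kernel differ by a permutation of
        \<open>Y\<close>: \<open>r\<close> carries the value of \<open>g\<close> on a class to that
        of \<open>u\<close>, and fixes all points off \<open>Y\<close> as \<open>permutes\<close>
        requires.\<close>
      define r where "r v = (if v \<in> Y then u (inv_into X g v) else v)" for v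
      have r: "r (g x) = u x" if "x \<in> X" for x
      proof -
        have "g x \<in> Y" "inv_into X g (g x) \<in> X" "g (inv_into X g (g x)) = g x"
          using that gU by (auto simp: inv_into_into f_inv_into_f)
        then have "(inv_into X g (g x), x) \<in> kernel_on X g"
          using that by (simp add: kernel_on_def)
        then show ?thesis
          using \<open>g x \<in> Y\<close> by (simp add: g(2) r_def) (simp add: kernel_on_def)
      qed
      have "r ` Y = u ` X"
        unfolding gU(2)[symmetric] using r by (force simp: image_image)
      then have "r ` Y = Y"
        using uU by simp
      then have "bij_betw r Y Y"
        using Y by (simp add: bij_betw_def eq_card_imp_inj_on)
      then have "r permutes Y"
        by (rule bij_imp_permutes) (simp add: r_def)
      then have "compose X r g \<in> ?M"
        using perm g(1) gU(1) by (blast intro: generated_subsemigroup.incl)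
      moreover have "compose X r g = u"
        using r uU(1) by (intro extensionalityI[of _ X]) (auto simp: compose_def PiE_iff)
      ultimately show ?thesis by simp
    qed
    show "full_maps X Y \<subseteq> ?M"
    proof
      fix f assume "f \<in> full_maps X Y"
      then show "f \<in> ?M"
      \<comment> \<open>Induction on the number of points of \<open>Y\<close> that \<open>f\<close>
        misses.\<close>
      proof (induction "card (Y - f ` X)" arbitrary: f rule: less_induct)
        case less
        show ?case
        proof (cases "f ` X = Y")
          case True
          then show ?thesis using UM less.prems by (simp add: U_def)
        next
          case False
          then obtain v where v: "v \<in> Y" "v \<notin> f ` X"
            using less.prems by blast
          have "card (a ` Y) < card X"
            using X aX a(3) by (intro psubset_card_mono) auto
          then have "card Y < card X"
            using a(2) by (simp add: card_image)
          moreover have "card (f ` X) \<le> card Y"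
            using less.prems Y by (intro card_mono) auto
          ultimately have "\<not> inj_on f X"
            by (metis card_image not_le)
          then obtain x1 x2 where x: "x1 \<in> X" "x2 \<in> X" "x1 \<noteq> x2" "f x1 = f x2"
            by (auto simp: inj_on_def)
          \<comment> \<open>The value \<open>f x1\<close> is still taken at \<open>x2\<close>, so
            \<open>x1\<close> can be redirected to the missed point \<open>v\<close>. After
            \<open>a\<close>, the map \<open>g\<close> sends \<open>v\<close> back to
            \<open>f x1\<close> and fixes the rest of \<open>Y\<close>; it stays surjective because
            \<open>x0\<close> goes to \<open>v\<close>.\<close>
          define h where "h = f(x1 := v)"
          define g where "g = (\<lambda>x\<in>X. if x = a v then f x1 else if x \<in> a ` Y then inv_into Y a x else v)"
          have h: "h \<in> full_maps X Y"
            using less.prems v(1) x(1) by (auto simp: h_def PiE_iff extensional_def)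
          have "f ` X \<subseteq> h ` X"
          proof
            fix w assume "w \<in> f ` X"
            then obtain z where "z \<in> X" "w = f z" by blast
            then show "w \<in> h ` X"
              using x by (cases "z = x1") (auto simp: h_def image_iff)
          qed
          moreover have "v \<in> h ` X"
            using x(1) by (auto simp: h_def)
          ultimately have "Y - h ` X \<subset> Y - f ` X"
            using v by blast
          then have "h \<in> ?M"
            using Y h by (intro less.hyps psubset_card_mono) auto
          have g_a: "g (a w) = (if w = v then f x1 else w)" if "w \<in> Y" for w
            using that aX a(2) v(1) by (auto simp: g_def inj_on_eq_iff)
          have "g \<in> U"
          proof -
            have "g ` X \<subseteq> Y"
              using v(1) less.prems x(1) by (auto simp: g_def inv_into_into)
            moreover have "w \<in> g ` X" if "w \<in> Y" for w
            proof (cases "w = v")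
              case True
              have "g x0 = v" using x0 v(1) by (auto simp: g_def)
              then show ?thesis using True x0(1) by blast
            next
              case False
              then show ?thesis using g_a[OF that] aX[OF that] by (metis imageI)
            qed
            ultimately show ?thesis
              by (auto simp: U_def g_def PiE_iff)
          qed
          have "sandwich X a h g \<in> ?M"
            using \<open>h \<in> ?M\<close> UM[OF \<open>g \<in> U\<close>] by (rule generated_subsemigroup.mult)
          moreover have "sandwich X a h g = f"
          proof (rule extensionalityI[of _ X])
            show "f \<in> extensional X" using less.prems by (simp add: PiE_iff)
            show "sandwich X a h g z = f z" if z: "z \<in> X" for z
              using z g_a v x less.prems h by (auto simp: sandwich_def compose_def h_def PiE_iff)
          qed (simp add: sandwich_def)
          ultimately show ?thesis by simp
        qed
      qed
    qed
  qed
  then show ?thesis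
    by (simp add: U_def kernels_of_surjections)
qed

section \<open>Sandwiching with a surjective, non-injective map\<close>

text \<open>The dual argument: the invariant is the image, \<open>U\<close> is the set of
  injections, and permutations of \<open>X\<close> act by precomposition. Here \<open>Y\<close> may
  be infinite, so all counting is done in \<open>X\<close>.\<close>

lemma semigroup_rank_sandwich_surjective:
  assumes X: "finite X" and a: "a \<in> full_maps Y X" "a ` Y = X" "\<not> inj_on a Y"
  shows "semigroup_rank (full_maps X Y) (sandwich X a) =o |{B. B \<subseteq> Y \<and> |B| =o |X| }|"
proof -
  define U where "U = {f \<in> full_maps X Y. inj_on f X}"
  define s where "s = inv_into Y a"
  have s: "s x \<in> Y" "a (s x) = x" if "x \<in> X" for x
    using that a(2) by (auto simp: s_def inv_into_into f_inv_into_f)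
  obtain y1 y2 where y: "y1 \<in> Y" "y2 \<in> Y" "y1 \<noteq> y2" "a y1 = a y2"
    using a(3) by (auto simp: inj_on_def)
  define x0 where "x0 = a y1"
  have x0: "x0 \<in> X" "a y1 = x0" "a y2 = x0"
    using y a(2) by (auto simp: x0_def)
  obtain p q where pq: "semigroup_generates {r. r permutes X} (\<circ>) {p, q}"
    using symmetric_group_two_generated[OF X] by blast
  then have pX: "p permutes X" and qX: "q permutes X"
    by (auto simp: semigroup_generates_def)
  \<comment> \<open>This is \<open>r\<close> followed by the section \<open>s\<close> of
    \<open>a\<close>, altered at \<open>x0\<close> to take the value \<open>v\<close>. For
    \<open>v\<close> over \<open>x0\<close>, left multiplication by it precomposes with
    \<open>r\<close>, and its image meets the fibre of \<open>x0\<close> only in \<open>v\<close>;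
    hence \<open>y1\<close> and \<open>y2\<close> give different images.\<close>
  define lift where "lift r v = (\<lambda>x\<in>X. (s(x0 := v)) (r x))" for r :: "'a \<Rightarrow> 'a" and v
  have lift: "lift r v \<in> full_maps X Y" "\<And>x. x \<in> X \<Longrightarrow> a (lift r v x) = r x"
    "lift r v \<in> U" "v \<in> lift r v ` X" "w \<in> lift r v ` X \<Longrightarrow> a w = x0 \<Longrightarrow> w = v"
    if r: "r permutes X" and v: "v \<in> Y" "a v = x0" for r v w
  proof -
    have rX: "r x \<in> X" if "x \<in> X" for x
      using that r by (simp add: permutes_in_image)
    show 1: "lift r v \<in> full_maps X Y"
      using rX s v by (auto simp: lift_def)
    show 2: "\<And>x. x \<in> X \<Longrightarrow> a (lift r v x) = r x"
      using rX s v by (simp add: lift_def)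
    have "inj_on (lift r v) X"
    proof (rule inj_onI)
      fix x x' assume "x \<in> X" "x' \<in> X" "lift r v x = lift r v x'"
      then have "r x = r x'" using 2 by metis
      then show "x = x'" by (rule injD[OF permutes_inj[OF r]])
    qed
    with 1 show "lift r v \<in> U" by (simp add: U_def)
    have "x0 \<in> r ` X"
      using permutes_image[OF r] x0(1) by simp
    then obtain x where "x \<in> X" "r x = x0"
      by blast
    then show "v \<in> lift r v ` X"
      by (auto simp: lift_def image_iff)
    show "w = v" if w: "w \<in> lift r v ` X" "a w = x0"
    proof -
      obtain x where x: "x \<in> X" "w = lift r v x"
        using w(1) by blast
      then have "r x = x0" using 2 w(2) by simp
      then show ?thesis using x by (simp add: lift_def)
    qed
  qed
  have "semigroup_rank (full_maps X Y) (sandwich X a) =o |(\<lambda>f. f ` X) ` U|"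
  proof (rule semigroup_rank_eq_card_of_invariant)
    show "sandwich X a f g \<in> full_maps X Y" if "f \<in> full_maps X Y" "g \<in> full_maps X Y" for f g
      using a(1) that by (rule sandwich_closed)
    show "U \<subseteq> full_maps X Y"
      by (auto simp: U_def)
    show "lift p y1 \<in> U" "lift q y2 \<in> U"
      using lift(3) pX qX y x0 by auto
    show "lift p y1 ` X \<noteq> lift q y2 ` X"
      using lift(4)[OF pX y(1) x0(2)] lift(5)[OF qX y(2) x0(3)] x0(2) y(3) by blast
  next
    fix f g assume fg: "f \<in> full_maps X Y" "g \<in> full_maps X Y" "sandwich X a f g \<in> U"
    have val: "sandwich X a f g x = g (a (f x))" if "x \<in> X" for x
      using that by (simp add: sandwich_def compose_def)
    \<comment> \<open>If the product is injective, so is the self-map \<open>b\<close> of the finite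
      set \<open>X\<close>; thus \<open>b\<close> is onto, and \<open>g\<close> inherits injectivity
      and the image.\<close>
    define b where "b x = a (f x)" for x
    have inj: "inj_on (g \<circ> b) X"
      using fg(3) val by (simp add: U_def b_def inj_on_def)
    have "b ` X \<subseteq> X"
      using fg(1) a(2) by (auto simp: b_def)
    then have b: "b ` X = X"
      using X inj_on_imageI2[OF inj] by (intro endo_inj_surj)
    have "inj_on g X"
      using inj_on_imageI[OF inj] b by simp
    moreover have "sandwich X a f g ` X = g ` b ` X"
      using val by (auto simp: b_def image_image)
    ultimately show "f \<in> U \<and> f ` X = sandwich X a f g ` X \<or>
        g \<in> U \<and> g ` X = sandwich X a f g ` X"
      using b fg(2) by (simp add: U_def)
  next
    fix G assume G: "G \<subseteq> U" "lift p y1 \<in> G" "lift q y2 \<in> G"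
      "(\<lambda>f. f ` X) ` G = (\<lambda>f. f ` X) ` U"
    let ?M = "generated_subsemigroup (sandwich X a) G"
    have "compose X f r \<in> ?M"
      if "r \<in> generated_subsemigroup (\<circ>) {p, q}" "f \<in> ?M" for r f
      using that
    proof (induction arbitrary: f)
      case (incl r)
      then obtain v where v: "lift r v \<in> G" "r permutes X" "v \<in> Y" "a v = x0"
        using G(2,3) pX qX y x0 by blast
      have "compose X f r = sandwich X a (lift r v) f"
        using lift(2)[OF v(2-4)] by (auto simp: compose_def sandwich_def fun_eq_iff)
      then show ?case
        using incl.prems v(1) by (auto intro: generated_subsemigroup.intros)
    next
      case (mult r t)
      have "t permutes X"
        using mult.hyps(2) pq by (auto simp: semigroup_generates_def)
      then have "compose X (compose X f r) t = compose X f (r \<circ> t)"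
        by (auto simp: compose_def fun_eq_iff permutes_in_image)
      then show ?case
        using mult by metis
    qed
    then have perm: "compose X f r \<in> ?M" if "r permutes X" "f \<in> ?M" for r f
      using that pq by (auto simp: semigroup_generates_def)
    have UM: "u \<in> ?M" if u: "u \<in> U" for u
    proof -
      have "u ` X \<in> (\<lambda>f. f ` X) ` G"
        using G(4) u by blast
      then obtain g where g: "g \<in> G" "g ` X = u ` X"
        by auto
      have inj: "inj_on g X" "inj_on u X"
        using g(1) G(1) u by (auto simp: U_def)
      \<comment> \<open>Two injections with the same image differ by a permutation of
        \<open>X\<close>: \<open>u\<close> followed by the inverse of \<open>g\<close>.\<close>
      define r where "r x = (if x \<in> X then inv_into X g (u x) else x)" for x
      have r: "r x \<in> X" "g (r x) = u x" if "x \<in> X" for x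
      proof -
        have "u x \<in> g ` X" using that g(2) by blast
        then show "r x \<in> X" "g (r x) = u x"
          using that by (simp_all add: r_def inv_into_into f_inv_into_f)
      qed
      have "inj_on r X"
        using r(2) inj(2) by (metis inj_on_def)
      moreover from this have "r ` X = X"
        using X r(1) by (intro endo_inj_surj) auto
      ultimately have "r permutes X"
        by (intro bij_imp_permutes) (auto simp: bij_betw_def r_def)
      then have "compose X g r \<in> ?M"
        using perm g(1) by (blast intro: generated_subsemigroup.incl)
      moreover have "compose X g r = u"
        using r u by (intro extensionalityI[of _ X]) (auto simp: U_def compose_def PiE_iff)
      ultimately show ?thesis by simp
    qed
    show "full_maps X Y \<subseteq> ?M"
    proof
      fix f assume "f \<in> full_maps X Y"
      then show "f \<in> ?M"
      \<comment> \<open>Induction on how far the rank of \<open>f\<close> falls short of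
        \<open>card X\<close>.\<close>
      proof (induction "card X - card (f ` X)" arbitrary: f rule: less_induct)
        case less
        show ?case
        proof (cases "inj_on f X")
          case True
          then show ?thesis using UM less.prems by (simp add: U_def)
        next
          case False
          then obtain x1 x2 where x: "x1 \<in> X" "x2 \<in> X" "x1 \<noteq> x2" "f x1 = f x2"
            by (auto simp: inj_on_def)
          have small: "card (f ` X) < card X"
            using False X card_image_le[OF X, of f] eq_card_imp_inj_on[OF X, of f] by linarith
          \<comment> \<open>Otherwise \<open>card X = card (a\<close> Y) \<le> card Y = card (f
            \<open>X) < card X\<close>.\<close>
          have "f ` X \<noteq> Y"
          proof
            assume *: "f ` X = Y"
            then have "card (a ` Y) \<le> card Y"
              using X by (intro card_image_le) auto
            then show False using small * a(2) by simp
          qed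
          then obtain v where v: "v \<in> Y" "v \<notin> f ` X"
            using less.prems by blast
          \<comment> \<open>only the point \<open>x0\<close> is known to have two preimages under \<open>a\<close>, so \<open>x1\<close> is moved there\<close>
          define \<sigma> where "\<sigma> = transpose x1 x0"
          have \<sigma>: "\<sigma> x1 = x0" "\<sigma> x0 = x1" "\<And>x. \<sigma> (\<sigma> x) = x" "\<And>x x'. \<sigma> x = \<sigma> x' \<longleftrightarrow> x = x'"
            "\<And>x. x \<in> X \<Longrightarrow> \<sigma> x \<in> X"
            using x(1) x0(1) by (auto simp: \<sigma>_def transpose_def)
          \<comment> \<open>Followed by \<open>a\<close>, the map \<open>k\<close> sends both
            \<open>x1\<close> and \<open>x2\<close> to \<open>x0\<close> and acts as
            \<open>\<sigma>\<close> elsewhere, so it never reaches \<open>\<sigma> x2\<close>. There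
            \<open>h\<close> is free to take the missed value \<open>v\<close>; elsewhere it undoes
            \<open>\<sigma>\<close> and applies \<open>f\<close>.\<close>
          define h where "h = (\<lambda>x\<in>X. if x = \<sigma> x2 then v else f (\<sigma> x))"
          define k where "k = (\<lambda>x\<in>X. if x = x1 then y1 else if x = x2 then y2 else s (\<sigma> x))"
          have fY: "f x \<in> Y" if "x \<in> X" for x
            using that less.prems by auto
          have h: "h \<in> full_maps X Y"
            using fY v(1) \<sigma>(5) by (auto simp: h_def)
          have "w \<in> h ` X" if "w \<in> f ` X" for w
          proof -
            from that obtain z where z: "z \<in> X" "w = f z" "z \<noteq> x2"
              using x by (metis imageE)
            then have "h (\<sigma> z) = w" "\<sigma> z \<in> X"
              using \<sigma> by (simp_all add: h_def)
            then show ?thesis by blast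
          qed
          moreover have "h (\<sigma> x2) = v" "\<sigma> x2 \<in> X"
            using x(2) \<sigma>(5) by (simp_all add: h_def)
          then have "v \<in> h ` X" by blast
          ultimately have "card (f ` X) < card (h ` X)"
            using v(2) X by (intro psubset_card_mono) auto
          then have "h \<in> ?M"
            using small h by (intro less.hyps) linarith+
          have ka: "a (k z) = (if z = x2 then x0 else \<sigma> z)" if "z \<in> X" for z
            using that \<sigma> x x0 s by (auto simp: k_def)
          have "k \<in> full_maps X Y"
            using y s \<sigma>(5) by (auto simp: k_def)
          moreover have "inj_on k X"
          proof (rule inj_onI)
            fix z z' assume z: "z \<in> X" "z' \<in> X" "k z = k z'"
            have k12: "k x1 = y1" "k x2 = y2"
              using x by (auto simp: k_def)
            \<comment> \<open>After \<open>a\<close>, only \<open>x1\<close> and \<open>x2\<close>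
              can be confused, and \<open>k\<close> separates these by \<open>y1\<close> and
              \<open>y2\<close>.\<close>
            have "(if z = x2 then \<sigma> x1 else \<sigma> z) = (if z' = x2 then \<sigma> x1 else \<sigma> z')"
              using ka[OF z(1)] ka[OF z(2)] unfolding \<sigma>(1) z(3) by metis
            then show "z = z'"
              using k12 z(3) y(3) \<sigma>(4) by (auto split: if_splits)
          qed
          ultimately have "k \<in> U"
            by (simp add: U_def)
          have "sandwich X a k h \<in> ?M"
            using UM[OF \<open>k \<in> U\<close>] \<open>h \<in> ?M\<close> by (rule generated_subsemigroup.mult)
          moreover have "sandwich X a k h = f"
          proof (rule extensionalityI[of _ X])
            show "f \<in> extensional X" using less.prems by (simp add: PiE_iff)
            fix z assume z: "z \<in> X"
            have "x0 \<noteq> \<sigma> x2"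
              using \<sigma>(1,4) x(3) by metis
            then have "h (if z = x2 then x0 else \<sigma> z) = f z"
              using z x x0(1) \<sigma> by (auto simp: h_def)
            then show "sandwich X a k h z = f z"
              using z ka[OF z] by (simp add: sandwich_def compose_def)
          qed (simp add: sandwich_def)
          ultimately show ?thesis by simp
        qed
      qed
    qed
  qed
  then show ?thesis
    by (simp add: U_def images_of_injections)
qed

section \<open>From cardinal hypotheses to injectivity and surjectivity\<close>

theorem theorem3p10:
  fixes X :: "'a set" and Y :: "'b set" and a :: "'b \<Rightarrow> 'a" and \<alpha> :: "'a rel"
  assumes "ctwo \<le>o |X|" and "|X| <o natLeq"
    and "ctwo \<le>o |Y|" and "|Y| \<le>o natLeq"
    and "a \<in> full_maps Y X"
    and "\<alpha> = map_rank Y a"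
  shows "(\<alpha> =o |Y| \<and> |Y| <o |X| \<longrightarrow>
            semigroup_rank (full_maps X Y) (sandwich X a) =o stirling_card |X| \<alpha>) \<and>
         (\<alpha> =o |X| \<and> |X| <o |Y| \<longrightarrow>
            semigroup_rank (full_maps X Y) (sandwich X a) =o binomial_card |Y| \<alpha>)"
proof (intro conjI impI; elim conjE)
  have X: "finite X"
    using assms(2) finite_iff_ordLess_natLeq by blast
  have aX: "a ` Y \<subseteq> X"
    using assms(5) by auto
  have \<alpha>: "\<alpha> = |a ` Y|"
    using assms(6) by (simp add: map_rank_def)
  show "semigroup_rank (full_maps X Y) (sandwich X a) =o stirling_card |X| \<alpha>"
    if \<alpha>Y: "\<alpha> =o |Y|" and less: "|Y| <o |X|"
  proof -
    \<comment> \<open>\<open>ctwo\<close> is the cardinal of \<open>bool\<close>, so an embedding of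
      \<open>bool\<close> yields two distinct points of \<open>Y\<close>.\<close>
    obtain b :: "bool \<Rightarrow> 'b" where b: "inj b" "range b \<subseteq> Y"
      using assms(3) unfolding ctwo_def by (metis card_of_ordLeq)
    then have "b True \<in> Y" "b False \<in> Y" "b True \<noteq> b False"
      by (auto dest: injD)
    moreover have "finite Y"
      using X aX \<alpha>Y card_of_ordIso_finite finite_subset unfolding \<alpha> by metis
    then have "inj_on a Y"
      using \<alpha>Y unfolding \<alpha>
      by (metis card_of_ordIso bij_betw_same_card eq_card_imp_inj_on)
    moreover have "a ` Y \<noteq> X"
      using \<alpha>Y less not_ordLess_ordIso ordIso_symmetric unfolding \<alpha> by metis
    ultimately have "semigroup_rank (full_maps X Y) (sandwich X a)
        =o |{E. equiv X E \<and> |X // E| =o |Y| }|"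
      using semigroup_rank_sandwich_injective[OF X assms(5)] by blast
    moreover have "|X // E| =o \<alpha> \<longleftrightarrow> |X // E| =o |Y|" for E
      using \<alpha>Y ordIso_symmetric ordIso_transitive by metis
    ultimately show ?thesis
      by (simp add: stirling_card_def Field_card_of)
  qed
  show "semigroup_rank (full_maps X Y) (sandwich X a) =o binomial_card |Y| \<alpha>"
    if \<alpha>X: "\<alpha> =o |X|" and less: "|X| <o |Y|"
  proof -
    have "card (a ` Y) = card X"
      using \<alpha>X unfolding \<alpha> by (metis card_of_ordIso bij_betw_same_card)
    then have im: "a ` Y = X"
      using card_seteq[OF X aX] by simp
    \<comment> \<open>An injection of \<open>Y\<close> into \<open>X\<close> would contradict
      \<open>|X| <o |Y|\<close>.\<close>
    then have "\<not> inj_on a Y"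
      using less not_ordLess_ordLeq card_of_ordLeq by (metis aX)
    then have "semigroup_rank (full_maps X Y) (sandwich X a) =o |{B. B \<subseteq> Y \<and> |B| =o |X| }|"
      using semigroup_rank_sandwich_surjective[OF X assms(5) im] by blast
    moreover have "|B| =o \<alpha> \<longleftrightarrow> |B| =o |X|" for B :: "'b set"
      using \<alpha>X ordIso_symmetric ordIso_transitive by metis
    ultimately show ?thesis
      by (simp add: binomial_card_def Field_card_of)
  qed
qed

end
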